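(* Let $G$ and $H$ be graphs and let $p$ be a positive integer. Then $$(G\,\square\, H)^{[\natural p]}=\biguplus_{i=0}^{p} \left(G^{[\natural i]}\times H^{[\natural p-i]}\right)\,.$$ Equivalently, $$(G\,\square\, H)^{[\natural p]}=\biguplus_{i=1}^{p-1} \left(G^{[\natural i]}\times H^{[\natural p-i]}\right)\uplus \left(G^{[\natural p]}\,\square\, H^{[\natural p]}\right)\,.$$
   Context: For a graph $G$ and a positive integer $p$, the exact distance-$p$ graph $G^{[\natural p]}$ has vertex set $V(G)$, two vertices being adjacent iff their distance in $G$ equals exactly $p$. $G^{[\natural 0]}$ is the graph on $V(G)$ with a loop at each vertex and no other edges. If $G$ and $H$ are graphs on the same vertex set, $G\uplus H$ is the graph on that vertex set with edge set $E(G)\cup E(H)$ (and $\biguplus$ denotes the iterated version). All products have vertex set $V(G)\times V(H)$. In the Cartesian product $G\,\square\,H$, $(g_1,h_1)(g_2,h_2)$ is an edge iff either $g_1g_2\in E(G)$ and $h_1=h_2$, or $g_1=g_2$ and $h_1h_2\in E(H)$. In the direct product $G\times H$, $(g_1,h_1)(g_2,h_2)$ is an edge iff $g_1g_2\in E(G)$ and $h_1h_2\in E(H)$ (where a loop at $g$ counts as $gg\in E(G)$). Equalities are equalities of graphs on the common vertex set $V(G)\times V(H)$. *)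

theory Defs
  imports "Graph_Theory.Pair_Digraph" "Graph_Theory.Shortest_Path"
begin

text \<open>
  An undirected graph, possibly infinite and possibly with loops, is a
  \<^locale>\<open>pair_sym_digraph\<close>: the edge between u and v is represented by the arcs (u,v) and (v,u),
  and a loop at v by the arc (v,v).
\<close>

definition gdist :: "'a pair_pre_digraph \<Rightarrow> 'a \<Rightarrow> 'a \<Rightarrow> ereal" where
  "gdist G u v = wf_digraph.\<mu> (with_proj G) (\<lambda>_. 1) u v"

definition exact_distance_graph :: "'a pair_pre_digraph \<Rightarrow> nat \<Rightarrow> 'a pair_pre_digraph" where
  "exact_distance_graph G p = \<lparr> pverts = pverts G,
     parcs = (if p = 0 then {(v, v) | v. v \<in> pverts G}
              else {(u, v). u \<in> pverts G \<and> v \<in> pverts G \<and> gdist G u v = ereal (real p)}) \<rparr>"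

definition graph_union ::
    "'a pair_pre_digraph \<Rightarrow> 'a pair_pre_digraph \<Rightarrow> 'a pair_pre_digraph" (infixl \<open>\<uplus>\<close> 65) where
  "G \<uplus> H = \<lparr> pverts = pverts G \<union> pverts H, parcs = parcs G \<union> parcs H \<rparr>"

text \<open>
  The iterated union over an empty index set is the graph without vertices, the neutral element
  of \<open>\<uplus>\<close>.
\<close>

definition graph_Union :: "'i set \<Rightarrow> ('i \<Rightarrow> 'a pair_pre_digraph) \<Rightarrow> 'a pair_pre_digraph" where
  "graph_Union I F = \<lparr> pverts = (\<Union>i\<in>I. pverts (F i)), parcs = (\<Union>i\<in>I. parcs (F i)) \<rparr>"

syntax "_graph_Union" :: "pttrn \<Rightarrow> 'i set \<Rightarrow> 'a pair_pre_digraph \<Rightarrow> 'a pair_pre_digraph"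
  (\<open>(3\<Uplus>_\<in>_./ _)\<close> [0, 0, 10] 10)
translations "\<Uplus>i\<in>I. G" \<rightleftharpoons> "CONST graph_Union I (\<lambda>i. G)"

definition cartesian_product ::
    "'a pair_pre_digraph \<Rightarrow> 'b pair_pre_digraph \<Rightarrow> ('a \<times> 'b) pair_pre_digraph"
    (infixl \<open>\<box>\<close> 70) where
  "G \<box> H = \<lparr> pverts = pverts G \<times> pverts H,
     parcs = {((g1, h1), (g2, h2)) | g1 h1 g2 h2.
       ((g1, g2) \<in> parcs G \<and> h1 = h2 \<and> h1 \<in> pverts H) \<or>
       (g1 = g2 \<and> g1 \<in> pverts G \<and> (h1, h2) \<in> parcs H)} \<rparr>"

definition direct_product ::
    "'a pair_pre_digraph \<Rightarrow> 'b pair_pre_digraph \<Rightarrow> ('a \<times> 'b) pair_pre_digraph"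
    (infixl \<open>\<times>\<^sub>d\<close> 70) where
  "G \<times>\<^sub>d H = \<lparr> pverts = pverts G \<times> pverts H,
     parcs = {((g1, h1), (g2, h2)) | g1 h1 g2 h2.
       (g1, g2) \<in> parcs G \<and> (h1, h2) \<in> parcs H} \<rparr>"

lemma pair_sym_digraph_iff:
  "pair_sym_digraph G \<longleftrightarrow> parcs G \<subseteq> pverts G \<times> pverts G \<and> sym (parcs G)"
  unfolding pair_sym_digraph_def pair_sym_digraph_axioms_def pair_wf_digraph_def symmetric_def
  by force

lemma pair_sym_digraph_cartesian_product:
  "pair_sym_digraph G \<Longrightarrow> pair_sym_digraph H \<Longrightarrow> pair_sym_digraph (G \<box> H)"
  unfolding pair_sym_digraph_iff cartesian_product_def by (auto simp: sym_def)

lemma gdist_eq: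
  assumes "pair_sym_digraph G"
  shows "gdist G u v = (INF p \<in> {p. pre_digraph.awalk (with_proj G) u p v}. ereal (real (length p)))"
proof -
  interpret pair_sym_digraph G by (rule assms)
  have "awalk_cost (\<lambda>_. 1) p = real (length p)" for p :: "('a \<times> 'a) list"
    by (induction p) auto
  then show ?thesis
    unfolding gdist_def wf_digraph.\<mu>_def[OF wf_digraph_axioms] by simp
qed

end

theory Submission
  imports Defs
begin

text \<open>
  A walk in the Cartesian product is an interleaving of a walk in each factor, so walks of
  length \<open>n\<close> in the product correspond to pairs of walks of lengths \<open>i\<close> and \<open>n - i\<close> in the factors.
  Consequently distances in the product are sums of distances in the factors.
\<close>

lemma relpow_Suc_iff_ex_first_step:
  "(a, b) \<in> R ^^ Suc n \<longleftrightarrow> (\<exists>c. (a, c) \<in> R \<and> (c, b) \<in> R ^^ n)"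
  by (metis relpow_Suc_D2 relpow_Suc_I2)

text \<open>Passing from arc lists to relation powers makes walk lengths accessible to induction on
  \<open>n\<close>. The start \<open>u\<close> must be a vertex because \<open>parcs G ^^ 0\<close>
  is the identity on the whole type, whereas the empty walk exists only at vertices.\<close>

lemma ex_awalk_length_iff_relpow:
  assumes "pair_sym_digraph G" and "u \<in> pverts G"
  shows "(\<exists>p. pre_digraph.awalk (with_proj G) u p v \<and> length p = n) \<longleftrightarrow> (u, v) \<in> parcs G ^^ n"
  using assms(2)
proof (induction n arbitrary: u)
  interpret pair_sym_digraph G by (rule assms(1))
  case 0
  then show ?case
    by (auto simp: awalk_Nil_iff)
next
  interpret pair_sym_digraph G by (rule assms(1))
  case (Suc n)
  have "(\<exists>p. awalk u p v \<and> length p = Suc n) \<longleftrightarrow>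
      (\<exists>w. (u, w) \<in> parcs G \<and> (\<exists>p. awalk w p v \<and> length p = n))" (is "?L \<longleftrightarrow> ?R")
  proof
    assume ?L
    then obtain e p where "awalk u (e # p) v" "length p = n"
      by (auto simp: length_Suc_conv)
    then have "(u, snd e) \<in> parcs G" "awalk (snd e) p v" "length p = n"
      by (auto simp: awalk_Cons_iff)
    then show ?R by blast
  next
    assume ?R
    then obtain w p where "awalk u ((u, w) # p) v" "length ((u, w) # p) = Suc n"
      by (auto simp: awalk_Cons_iff)
    then show ?L by blast
  qed
  \<comment> \<open>The induction hypothesis applies at \<open>w\<close> because the head of an arc
    is a vertex.\<close>
  also have "\<dots> \<longleftrightarrow> (\<exists>w. (u, w) \<in> parcs G \<and> (w, v) \<in> parcs G ^^ n)"
    using Suc.IH in_arcsD2 by blast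
  also have "\<dots> \<longleftrightarrow> (u, v) \<in> parcs G ^^ Suc n"
    by (simp only: relpow_Suc_iff_ex_first_step)
  finally show ?case .
qed

text \<open>A nonempty set of natural numbers attains its infimum at its least element. Over an
  empty index set the infimum is \<infinity>, which is no natural number, so both sides
  fail.\<close>

lemma INF_ereal_of_nat_eq_iff:
  fixes f :: "'a \<Rightarrow> nat"
  shows "(INF x \<in> A. ereal (real (f x))) = ereal (real n) \<longleftrightarrow>
    n \<in> f ` A \<and> (\<forall>m<n. m \<notin> f ` A)"
proof (cases "A = {}")
  case True
  then show ?thesis by (simp add: top_ereal_def)
next
  case False
  define k where "k = (LEAST k. k \<in> f ` A)"
  have k: "k \<in> f ` A"
    unfolding k_def using False by (metis LeastI_ex ex_in_conv image_is_empty)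
  have k_le: "k \<le> f x" if "x \<in> A" for x
    unfolding k_def using that by (intro Least_le) auto
  have "(INF x \<in> A. ereal (real (f x))) = ereal (real k)"
    using k k_le by (intro antisym INF_greatest) (auto intro: INF_lower2)
  moreover have "k = n \<longleftrightarrow> n \<in> f ` A \<and> (\<forall>m<n. m \<notin> f ` A)"
    using k k_le by (metis imageE linorder_neqE_nat not_le)
  ultimately show ?thesis by simp
qed

lemma gdist_eq_of_nat_iff:
  assumes "pair_sym_digraph G" and "u \<in> pverts G"
  shows "gdist G u v = ereal (real n) \<longleftrightarrow>
    (u, v) \<in> parcs G ^^ n \<and> (\<forall>m<n. (u, v) \<notin> parcs G ^^ m)"
proof -
  have "m \<in> length ` {p. pre_digraph.awalk (with_proj G) u p v} \<longleftrightarrow> (u, v) \<in> parcs G ^^ m" for m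
    using ex_awalk_length_iff_relpow[OF assms, of v m] by auto
  then show ?thesis
    by (simp only: gdist_eq[OF assms(1)] INF_ereal_of_nat_eq_iff)
qed

text \<open>The loops chosen for \<open>p = 0\<close> fit the general pattern: the zeroth power is
  the identity and the minimality condition is vacuous. Later arguments thus need no case split on
  \<open>p\<close>.\<close>

lemma parcs_exact_distance_graph_iff:
  assumes "pair_sym_digraph G"
  shows "(u, v) \<in> parcs (exact_distance_graph G p) \<longleftrightarrow>
    u \<in> pverts G \<and> v \<in> pverts G \<and> (u, v) \<in> parcs G ^^ p \<and> (\<forall>m<p. (u, v) \<notin> parcs G ^^ m)"
  using gdist_eq_of_nat_iff[OF assms] by (auto simp: exact_distance_graph_def)

lemma pverts_exact_distance_graph [simp]: "pverts (exact_distance_graph G p) = pverts G"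
  by (simp add: exact_distance_graph_def)

lemma parcs_exact_distance_graph_0:
  "(u, v) \<in> parcs (exact_distance_graph G 0) \<longleftrightarrow> u = v \<and> u \<in> pverts G"
  by (auto simp: exact_distance_graph_def)

lemma pverts_cartesian_product [simp]: "pverts (G \<box> H) = pverts G \<times> pverts H"
  by (simp add: cartesian_product_def)

lemma parcs_cartesian_product_iff:
  "((g, h), (g', h')) \<in> parcs (G \<box> H) \<longleftrightarrow>
    (g, g') \<in> parcs G \<and> h = h' \<and> h \<in> pverts H \<or> g = g' \<and> g \<in> pverts G \<and> (h, h') \<in> parcs H"
  by (auto simp: cartesian_product_def)

lemma pverts_direct_product [simp]: "pverts (G \<times>\<^sub>d H) = pverts G \<times> pverts H"
  by (simp add: direct_product_def)

lemma parcs_direct_product_iff: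
  "((g, h), (g', h')) \<in> parcs (G \<times>\<^sub>d H) \<longleftrightarrow> (g, g') \<in> parcs G \<and> (h, h') \<in> parcs H"
  by (auto simp: direct_product_def)

text \<open>Induction on \<open>n\<close>, splitting off the first step: it changes at most one
  coordinate and is credited to the walk in that factor.\<close>

lemma relpow_cartesian_product_iff:
  assumes "pair_sym_digraph G" and "pair_sym_digraph H"
    and "g \<in> pverts G" and "h \<in> pverts H"
  shows "((g, h), (g', h')) \<in> parcs (G \<box> H) ^^ n \<longleftrightarrow>
    (\<exists>i j. n = i + j \<and> (g, g') \<in> parcs G ^^ i \<and> (h, h') \<in> parcs H ^^ j)"
  using assms(3,4)
proof (induction n arbitrary: g h)
  case 0
  then show ?case by auto
next
  case (Suc n)
  have verts: "x \<in> pverts G" if "(g, x) \<in> parcs G" for x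
    using that assms(1) by (auto simp: pair_sym_digraph_iff)
  have verts': "x \<in> pverts H" if "(h, x) \<in> parcs H" for x
    using that assms(2) by (auto simp: pair_sym_digraph_iff)
  have "((g, h), (g', h')) \<in> parcs (G \<box> H) ^^ Suc n \<longleftrightarrow>
      (\<exists>x y. ((g, h), (x, y)) \<in> parcs (G \<box> H) \<and> ((x, y), (g', h')) \<in> parcs (G \<box> H) ^^ n)"
    by (simp only: relpow_Suc_iff_ex_first_step split_paired_Ex)
  \<comment> \<open>The coordinate that stays fixed is a vertex by \<open>Suc.prems\<close>, as an
    arc of the product demands.\<close>
  also have "\<dots> \<longleftrightarrow>
      (\<exists>x. (g, x) \<in> parcs G \<and> ((x, h), (g', h')) \<in> parcs (G \<box> H) ^^ n) \<or>
      (\<exists>y. (h, y) \<in> parcs H \<and> ((g, y), (g', h')) \<in> parcs (G \<box> H) ^^ n)"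
    using Suc.prems by (auto simp: parcs_cartesian_product_iff)
  also have "\<dots> \<longleftrightarrow>
      (\<exists>x i j. n = i + j \<and> (g, x) \<in> parcs G \<and> (x, g') \<in> parcs G ^^ i \<and> (h, h') \<in> parcs H ^^ j) \<or>
      (\<exists>y i j. n = i + j \<and> (g, g') \<in> parcs G ^^ i \<and> (h, y) \<in> parcs H \<and> (y, h') \<in> parcs H ^^ j)"
    using Suc.IH Suc.prems verts verts' by blast
  also have "\<dots> \<longleftrightarrow>
      (\<exists>i j. n = i + j \<and> (g, g') \<in> parcs G ^^ Suc i \<and> (h, h') \<in> parcs H ^^ j) \<or>
      (\<exists>i j. n = i + j \<and> (g, g') \<in> parcs G ^^ i \<and> (h, h') \<in> parcs H ^^ Suc j)"
    unfolding relpow_Suc_iff_ex_first_step by blast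
  also have "\<dots> \<longleftrightarrow>
      (\<exists>i j. Suc n = i + j \<and> (g, g') \<in> parcs G ^^ i \<and> (h, h') \<in> parcs H ^^ j)"
    (is "?L \<longleftrightarrow> ?R")
  proof
    assume ?L
    then show ?R by (metis add_Suc add_Suc_right)
  next
    assume ?R
    then obtain i j where ij: "Suc n = i + j" "(g, g') \<in> parcs G ^^ i" "(h, h') \<in> parcs H ^^ j"
      by blast
    \<comment> \<open>For \<open>i = 0\<close> all \<open>Suc n\<close> steps lie in
      \<open>H\<close>, so the surplus step is taken there; otherwise it is taken from
      \<open>G\<close>.\<close>
    show ?L
    proof (cases i)
      case 0
      with ij show ?thesis by (metis add_0)
    next
      case (Suc k)
      with ij show ?thesis by (metis add_Suc nat.inject)
    qed
  qed
  finally show ?case .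
qed

text \<open>Lengths of walks in the product are exactly the sums of lengths of walks in the factors,
  and such a sum is least precisely when both summands are.\<close>

lemma parcs_exact_distance_graph_cartesian_product_iff:
  assumes "pair_sym_digraph G" and "pair_sym_digraph H"
  shows "((g, h), (g', h')) \<in> parcs (exact_distance_graph (G \<box> H) p) \<longleftrightarrow>
    (\<exists>i\<le>p. (g, g') \<in> parcs (exact_distance_graph G i) \<and>
      (h, h') \<in> parcs (exact_distance_graph H (p - i)))"
    (is "?L \<longleftrightarrow> ?R")
proof (cases "g \<in> pverts G \<and> h \<in> pverts H")
  case False
  then show ?thesis
    using assms by (auto simp: parcs_exact_distance_graph_iff pair_sym_digraph_cartesian_product)
next
  case True
  note dist_iff = parcs_exact_distance_graph_iff[OF assms(1)]
    parcs_exact_distance_graph_iff[OF assms(2)]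
    parcs_exact_distance_graph_iff[OF pair_sym_digraph_cartesian_product[OF assms]]
  note walk_iff = relpow_cartesian_product_iff[OF assms conjunct1[OF True] conjunct2[OF True]]
  show ?thesis
  proof
    assume ?L
    then obtain i j where ij: "p = i + j" "(g, g') \<in> parcs G ^^ i" "(h, h') \<in> parcs H ^^ j"
      and min: "\<And>k l. (g, g') \<in> parcs G ^^ k \<Longrightarrow> (h, h') \<in> parcs H ^^ l \<Longrightarrow> i + j \<le> k + l"
      and verts: "g' \<in> pverts G" "h' \<in> pverts H"
      unfolding dist_iff walk_iff by (metis SigmaD1 SigmaD2 not_less pverts_cartesian_product)
    \<comment> \<open>A shorter walk in one factor, combined with the walk already found in the
      other, would give a product walk shorter than \<open>p\<close>.\<close>
    have "\<forall>k<i. (g, g') \<notin> parcs G ^^ k"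
      using min[OF _ ij(3)] by fastforce
    moreover have "\<forall>l<j. (h, h') \<notin> parcs H ^^ l"
      using min[OF ij(2)] by fastforce
    ultimately show ?R
      using ij True verts unfolding dist_iff by (intro exI[of _ i]) auto
  next
    assume ?R
    then obtain i j where ij: "p = i + j" "(g, g') \<in> parcs G ^^ i" "(h, h') \<in> parcs H ^^ j"
      and min: "\<And>k. (g, g') \<in> parcs G ^^ k \<Longrightarrow> i \<le> k" "\<And>l. (h, h') \<in> parcs H ^^ l \<Longrightarrow> j \<le> l"
      and verts: "g' \<in> pverts G" "h' \<in> pverts H"
      unfolding dist_iff by (metis le_add_diff_inverse not_less)
    have "\<not> k + l < p" if "(g, g') \<in> parcs G ^^ k" "(h, h') \<in> parcs H ^^ l" for k l
      using min(1)[OF that(1)] min(2)[OF that(2)] ij(1) by linarith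
    then show ?L
      using ij True verts unfolding dist_iff walk_iff by auto
  qed
qed

theorem theorem2p2:
  fixes G :: "'a pair_pre_digraph" and H :: "'b pair_pre_digraph" and p :: nat
  assumes "pair_sym_digraph G" and "pair_sym_digraph H" and "p > 0"
  shows "exact_distance_graph (G \<box> H) p =
           (\<Uplus>i\<in>{0..p}. exact_distance_graph G i \<times>\<^sub>d exact_distance_graph H (p - i))
       \<and> exact_distance_graph (G \<box> H) p =
           (\<Uplus>i\<in>{1..p - 1}. exact_distance_graph G i \<times>\<^sub>d exact_distance_graph H (p - i))
             \<uplus> (exact_distance_graph G p \<box> exact_distance_graph H p)"
proof -
  let ?U = "\<lambda>I. \<Uplus>i\<in>I. exact_distance_graph G i \<times>\<^sub>d exact_distance_graph H (p - i)"
  have first: "exact_distance_graph (G \<box> H) p = ?U {0..p}"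
  proof (rule pair_pre_digraph.equality)
    show "parcs (exact_distance_graph (G \<box> H) p) = parcs (?U {0..p})"
      by (auto simp: graph_Union_def parcs_direct_product_iff Bex_def
          parcs_exact_distance_graph_cartesian_product_iff[OF assms(1,2)])
  qed (simp_all add: graph_Union_def)
  \<comment> \<open>The two end terms form the Cartesian product: the loops at distance
    \<open>0\<close> freeze the first coordinate for \<open>i = 0\<close> and the second for
    \<open>i = p\<close>. For \<open>p = 1\<close> the remaining union is empty and has no vertices,
    so the Cartesian term supplies the whole vertex set.\<close>
  have split: "{0..p} = insert 0 (insert p {1..p - 1})"
    using assms(3) by auto
  have "?U {0..p} = ?U {1..p - 1} \<uplus> (exact_distance_graph G p \<box> exact_distance_graph H p)"
  proof (rule pair_pre_digraph.equality)
    show "parcs (?U {0..p}) =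
        parcs (?U {1..p - 1} \<uplus> (exact_distance_graph G p \<box> exact_distance_graph H p))"
      unfolding split
      by (auto simp: graph_Union_def graph_union_def parcs_direct_product_iff
          parcs_cartesian_product_iff parcs_exact_distance_graph_0)
  qed (auto simp: graph_Union_def graph_union_def)
  with first show ?thesis by simp
qed

end
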